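(* Let $\mathbf{A}=[\underline{A},\overline{A}]$ be an $n\times n$ real interval matrix that is totally positive. Then $\det(\mathbf{A})=[\min(\mathcal{D}),\max(\mathcal{D})]$, where $\mathcal{D}=\{\det(\downarrow A),\det(\uparrow A)\}$.
   Context: Inequalities between matrices are entrywise. For $\underline{A}\le\overline{A}$ in $\mathbb{R}^{n\times n}$, the interval matrix is $\mathbf{A}=\{A\in\mathbb{R}^{n\times n} : \underline{A}\le A\le\overline{A}\}$, with midpoint $A^c=\frac12(\underline{A}+\overline{A})$ and radius $A^\Delta=\frac12(\overline{A}-\underline{A})$. A matrix in $\mathbb{R}^{n\times n}$ is totally positive if the determinants of all its square submatrices (all minors) are positive; $\mathbf{A}$ is totally positive if every $A\in\mathbf{A}$ is. Let $s=(1,-1,1,-1,\dots)^T\in\mathbb{R}^n$, let $\operatorname{diag}(s)$ be the diagonal matrix with diagonal $s$, and put $\downarrow A=A^c-\operatorname{diag}(s)A^\Delta\operatorname{diag}(s)$, $\uparrow A=A^c+\operatorname{diag}(s)A^\Delta\operatorname{diag}(s)$. The range of the determinant is $\det(\mathbf{A})=\{\det(A) : A\in\mathbf{A}\}$. *)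

theory Defs
  imports
    Complex_Main
    "Jordan_Normal_Form.Determinant"
    "Jordan_Normal_Form.DL_Submatrix"
begin

text \<open>
  The order on \<^typ>\<open>real mat\<close> is the entrywise one and relates only matrices of
  equal dimensions. Hence for \<open>L\<close>, \<open>U\<close> in \<^term>\<open>carrier_mat n n\<close> the
  interval matrix with bounds \<open>L\<close>, \<open>U\<close> is the library's \<open>{L..U}\<close>.
\<close>

definition mid_mat :: "real mat \<Rightarrow> real mat \<Rightarrow> real mat" where
  "mid_mat L U = (1 / 2) \<cdot>\<^sub>m (L + U)"

definition rad_mat :: "real mat \<Rightarrow> real mat \<Rightarrow> real mat" where
  "rad_mat L U = (1 / 2) \<cdot>\<^sub>m (U - L)"

text \<open>Indices start at 0, so the diagonal of the following matrix is \<open>1, -1, 1, -1, \<dots>\<close>.\<close>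

definition sign_diag :: "nat \<Rightarrow> real mat" where
  "sign_diag n = mat_diag n (\<lambda>i. (- 1) ^ i)"

definition down_mat :: "nat \<Rightarrow> real mat \<Rightarrow> real mat \<Rightarrow> real mat" where
  "down_mat n L U = mid_mat L U - sign_diag n * rad_mat L U * sign_diag n"

definition up_mat :: "nat \<Rightarrow> real mat \<Rightarrow> real mat \<Rightarrow> real mat" where
  "up_mat n L U = mid_mat L U + sign_diag n * rad_mat L U * sign_diag n"

definition totally_positive :: "real mat \<Rightarrow> bool" where
  "totally_positive A \<longleftrightarrow>
     (\<forall>I J. I \<subseteq> {..<dim_row A} \<longrightarrow> J \<subseteq> {..<dim_col A} \<longrightarrow> I \<noteq> {} \<longrightarrow> card I = card J \<longrightarrow>
       det (submatrix A I J) > 0)"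

end

theory Submission
  imports Defs
begin

text \<open>
  By total positivity the cofactor at \<open>(i, j)\<close> of every matrix in the interval has the sign
  \<open>(-1)^(i+j)\<close>, so the determinant is increasing on the interval in the entries with \<open>i + j\<close>
  even and decreasing in the others. It is therefore smallest at one of the two checkerboard
  vertices and largest at the other, and it takes every value in between along the segment
  joining them.
\<close>

text \<open>An element of a set with exactly \<open>k\<close> smaller elements in it is what
  \<open>pick\<close> returns at \<open>k\<close>. Leaving out \<open>i\<close> shifts the indices
  from \<open>i\<close> on by one, as \<open>mat_delete\<close> does.\<close>

lemma pick_lessThan_delete:
  assumes "k < n - 1" and "i < n"
  shows "pick ({..<n} - {i}) k = (if k < i then k else Suc k)"
proof -
  let ?x = "if k < i then k else Suc k"
  have "{a \<in> {..<n} - {i}. a < ?x} = (if k < i then {..<k} else {..<Suc k} - {i})"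
    using assms by auto
  then have "card {a \<in> {..<n} - {i}. a < ?x} = k"
    by (auto simp: card_Diff_singleton)
  moreover have "?x \<in> {..<n} - {i}"
    using assms by auto
  ultimately show ?thesis
    using pick_card_in_set[of ?x "{..<n} - {i}"] by simp
qed

text \<open>Links the minors in cofactors, built with \<open>mat_delete\<close>, to those in
  \<open>totally_positive\<close>, built with \<open>submatrix\<close>.\<close>

lemma mat_delete_eq_submatrix:
  assumes "A \<in> carrier_mat m n" and "i < m" and "j < n"
  shows "mat_delete A i j = submatrix A ({..<m} - {i}) ({..<n} - {j})"
proof -
  \<comment> \<open>\<open>submatrix\<close> takes its dimensions from cardinalities of sets of this
    shape.\<close>
  have "{a. a < k \<and> a \<in> {..<k} - {i}} = {..<k} - {i}" for k i :: nat
    by auto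
  then have "card {a. a < m \<and> a \<in> {..<m} - {i}} = m - 1"
    and "card {a. a < n \<and> a \<in> {..<n} - {j}} = n - 1"
    using assms by simp_all
  then show ?thesis
    using assms unfolding mat_delete_def submatrix_def
    by (intro eq_matI) (auto simp: pick_lessThan_delete)
qed

lemma totally_positive_mat_delete:
  assumes "totally_positive A" and A: "A \<in> carrier_mat n n" and ij: "i < n" "j < n"
  shows "det (mat_delete A i j) > 0"
\<comment> \<open>\<open>totally_positive\<close> speaks only of nonempty index sets; for
  \<open>n = 1\<close> the minor is the empty determinant, which is 1.\<close>
proof (cases "n = 1")
  case True
  then have "mat_delete A i j \<in> carrier_mat 0 0"
    using A by (simp add: mat_delete_def)
  then show ?thesis by simp
next
  case False
  let ?I = "{..<n} - {i}" and ?J = "{..<n} - {j}"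
  have "card ?I = n - 1" "card ?J = n - 1"
    using ij by simp_all
  moreover from this have "?I \<noteq> {}"
    using False ij by force
  ultimately have "det (submatrix A ?I ?J) > 0"
    using assms unfolding totally_positive_def by auto
  then show ?thesis
    using mat_delete_eq_submatrix[OF A ij] by simp
qed

lemma mat_delete_cong_other_rows:
  assumes "A \<in> carrier_mat n m" and "B \<in> carrier_mat n m" and "k < n" and "j < m"
    and "\<And>i j. i < n \<Longrightarrow> j < m \<Longrightarrow> i \<noteq> k \<Longrightarrow> A $$ (i, j) = B $$ (i, j)"
  shows "mat_delete A k j = mat_delete B k j"
proof -
  have "dim_row A = n" "dim_col A = m" "dim_row B = n" "dim_col B = m"
    using assms(1,2) by auto
  then show ?thesis
    using assms(3,4) unfolding mat_delete_def by (intro cong_mat) (simp_all add: assms(5))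
qed

lemma mem_interval_mat_iff:
  assumes "L \<in> carrier_mat m n" and "U \<in> carrier_mat m n"
  shows "A \<in> {L..U} \<longleftrightarrow> A \<in> carrier_mat m n \<and>
    (\<forall>i<m. \<forall>j<n. L $$ (i, j) \<le> A $$ (i, j) \<and> A $$ (i, j) \<le> U $$ (i, j))"
proof -
  have "dim_row L = m" "dim_col L = n" "dim_row U = m" "dim_col U = n"
    using assms by auto
  then show ?thesis
    unfolding atLeastAtMost_iff less_eq_mat_def carrier_mat_def mem_Collect_eq by metis
qed

text \<open>\<open>A\<close> is turned into \<open>B\<close> one row at a time. Laplace expansion
  along the changing row makes the determinant linear in that row, with coefficients whose signs
  total positivity fixes.\<close>

lemma det_mono_checkerboard:
  fixes A B L U :: "real mat"
  assumes L: "L \<in> carrier_mat n n" and U: "U \<in> carrier_mat n n"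
    and tp: "\<And>M. M \<in> {L..U} \<Longrightarrow> totally_positive M"
    and A: "A \<in> {L..U}" and B: "B \<in> {L..U}"
    and AB: "\<And>i j. i < n \<Longrightarrow> j < n \<Longrightarrow> (- 1) ^ (i + j) * A $$ (i, j) \<le> (- 1) ^ (i + j) * B $$ (i, j)"
  shows "det A \<le> det B"
proof -
  define M where "M k = mat n n (\<lambda>(i, j). if i < k then B $$ (i, j) else A $$ (i, j))" for k
  have Ac: "A \<in> carrier_mat n n" and Bc: "B \<in> carrier_mat n n"
    using A B mem_interval_mat_iff[OF L U] by blast+
  have Mc: "M k \<in> carrier_mat n n" for k
    by (simp add: M_def)
  \<comment> \<open>Every row of \<open>M k\<close> is a row of \<open>A\<close> or of
    \<open>B\<close>, so the hybrids stay in the interval and are totally positive.\<close>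
  have M_box: "M k \<in> {L..U}" for k
    using A B unfolding mem_interval_mat_iff[OF L U] by (simp add: M_def)
  have step: "det (M k) \<le> det (M (Suc k))" if k: "k < n" for k
  proof -
    \<comment> \<open>The two hybrids differ only in row \<open>k\<close>, which the cofactor
      deletes.\<close>
    have cof: "cofactor (M (Suc k)) k j = cofactor (M k) k j" if "j < n" for j
      using mat_delete_cong_other_rows[OF Mc Mc k that, of "Suc k" k]
      by (auto simp: cofactor_def M_def less_Suc_eq)
    have "A $$ (k, j) * cofactor (M k) k j \<le> B $$ (k, j) * cofactor (M k) k j"
      if j: "j < n" for j
    proof -
      have "det (mat_delete (M k) k j) > 0"
        using totally_positive_mat_delete[OF tp[OF M_box] Mc k j] .
      \<comment> \<open>The sign \<open>(-1)^(k+j)\<close> in \<open>AB\<close> times the positive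
        minor is the cofactor.\<close>
      from mult_right_mono[OF AB[OF k j] less_imp_le[OF this]] show ?thesis
        by (simp add: cofactor_def mult_ac)
    qed
    then have "(\<Sum>j<n. M k $$ (k, j) * cofactor (M k) k j)
        \<le> (\<Sum>j<n. M (Suc k) $$ (k, j) * cofactor (M (Suc k)) k j)"
      using k by (intro sum_mono) (simp add: cof, simp add: M_def)
    then show ?thesis
      using laplace_expansion_row[OF Mc k] by metis
  qed
  have "det (M 0) \<le> det (M k)" if "k \<le> n" for k
    using that
  proof (induction k)
    case (Suc k)
    then show ?case
      using step[of k] by simp
  qed simp
  from this[of n] have "det (M 0) \<le> det (M n)"
    by simp
  moreover have "M 0 = A" "M n = B"
    using Ac Bc by (auto simp: M_def)
  ultimately show ?thesis
    by simp
qed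

text \<open>By the Leibniz formula the determinant is a finite sum of signed products of
  entries.\<close>

lemma continuous_on_det_mat:
  fixes f :: "'a::topological_space \<Rightarrow> nat \<times> nat \<Rightarrow> real"
  assumes "\<And>i j. i < n \<Longrightarrow> j < n \<Longrightarrow> continuous_on S (\<lambda>t. f t (i, j))"
  shows "continuous_on S (\<lambda>t. det (mat n n (f t)))"
proof -
  have perm: "p i < n" if "p permutes {0..<n}" "i < n" for p i
    using permutes_in_image[OF that(1), of i] that(2) by simp
  have "det (mat n n (f t)) =
      (\<Sum>p | p permutes {0..<n}. signof p * (\<Prod>i = 0..<n. f t (i, p i)))" for t
    unfolding det_def'[OF mat_carrier]
    by (intro sum.cong prod.cong arg_cong2[of _ _ _ _ "(*)"]) (simp_all add: perm)
  moreover have "continuous_on S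
      (\<lambda>t. \<Sum>p | p permutes {0..<n}. signof p * (\<Prod>i = 0..<n. f t (i, p i)))"
    by (intro continuous_on_sum continuous_on_mult continuous_on_const continuous_on_prod assms)
      (simp_all add: perm)
  ultimately show ?thesis
    by simp
qed

text \<open>The interval is convex, so it contains the segment from \<open>P\<close> to
  \<open>Q\<close>; the intermediate value theorem along it gives every value between the two
  extremes.\<close>

lemma det_image_interval_eq_Icc:
  fixes L U P Q :: "real mat"
  assumes L: "L \<in> carrier_mat n n" and U: "U \<in> carrier_mat n n"
    and P: "P \<in> {L..U}" and Q: "Q \<in> {L..U}"
    and bounds: "\<And>A. A \<in> {L..U} \<Longrightarrow> det P \<le> det A \<and> det A \<le> det Q"
  shows "det ` {L..U} = {det P..det Q}"
proof (intro equalityI subsetI)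
  fix y assume "y \<in> {det P..det Q}"
  define M where "M t = mat n n (\<lambda>ij. (1 - t) * P $$ ij + t * Q $$ ij)" for t :: real
  have "M 0 = P" "M 1 = Q"
    using P Q unfolding mem_interval_mat_iff[OF L U] by (auto simp: M_def)
  moreover have "continuous_on {0..1} (\<lambda>t. det (M t))"
    unfolding M_def by (intro continuous_on_det_mat continuous_intros)
  ultimately obtain t where t: "0 \<le> t" "t \<le> 1" "det (M t) = y"
    using IVT'[of "\<lambda>t. det (M t)" 0 y 1] \<open>y \<in> {det P..det Q}\<close> by auto
  have between: "a \<le> (1 - t) * p + t * q \<and> (1 - t) * p + t * q \<le> b"
    if "a \<le> p \<and> p \<le> b" "a \<le> q \<and> q \<le> b" for a b p q :: real
    \<comment> \<open>The second instance, with all signs flipped, gives the lower bound.\<close>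
    using t that convex_bound_le[of p b q "1 - t" t] convex_bound_le[of "- p" "- a" "- q" "1 - t" t]
    by simp
  have "M t \<in> {L..U}"
    unfolding mem_interval_mat_iff[OF L U]
  proof (intro conjI allI impI)
    fix i j assume ij: "i < n" "j < n"
    then have "L $$ (i, j) \<le> P $$ (i, j) \<and> P $$ (i, j) \<le> U $$ (i, j)"
      and "L $$ (i, j) \<le> Q $$ (i, j) \<and> Q $$ (i, j) \<le> U $$ (i, j)"
      using P Q mem_interval_mat_iff[OF L U] by blast+
    from between[OF this]
    have "L $$ (i, j) \<le> M t $$ (i, j) \<and> M t $$ (i, j) \<le> U $$ (i, j)"
      using ij by (simp add: M_def)
    then show "L $$ (i, j) \<le> M t $$ (i, j)" "M t $$ (i, j) \<le> U $$ (i, j)"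
      by auto
  qed (simp add: M_def)
  then show "y \<in> det ` {L..U}"
    using t by blast
next
  fix y assume "y \<in> det ` {L..U}"
  then obtain A where "A \<in> {L..U}" and y: "y = det A"
    by (rule imageE)
  from bounds[OF this(1)] show "y \<in> {det P..det Q}"
    by (simp add: y)
qed

text \<open>Conjugation by the sign matrix multiplies entry \<open>(i, j)\<close> of the radius by
  \<open>(-1)^(i+j)\<close>, and midpoint minus or plus radius is the lower or upper bound.\<close>

lemma checkerboard_index:
  assumes "L \<in> carrier_mat n n" and "U \<in> carrier_mat n n" and "i < n" and "j < n"
  shows "down_mat n L U $$ (i, j) = (if even (i + j) then L $$ (i, j) else U $$ (i, j))"
    and "up_mat n L U $$ (i, j) = (if even (i + j) then U $$ (i, j) else L $$ (i, j))"
proof -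
  have R: "rad_mat L U \<in> carrier_mat n n"
    using assms by (auto simp: rad_mat_def)
  have S: "sign_diag n * rad_mat L U * sign_diag n
      = mat n n (\<lambda>(i, j). (- 1) ^ i * rad_mat L U $$ (i, j) * (- 1) ^ j)"
    unfolding sign_diag_def mat_diag_mult_left[OF R]
    by (subst mat_diag_mult_right[of _ n n]) auto
  show "down_mat n L U $$ (i, j) = (if even (i + j) then L $$ (i, j) else U $$ (i, j))"
    and "up_mat n L U $$ (i, j) = (if even (i + j) then U $$ (i, j) else L $$ (i, j))"
    using assms unfolding down_mat_def up_mat_def S
    by (auto simp: mid_mat_def rad_mat_def minus_one_power_iff field_simps)
qed

theorem corollary2:
  fixes n :: nat and L U :: "real mat" and D :: "real set"
  assumes "L \<in> carrier_mat n n" and "U \<in> carrier_mat n n"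
    and "L \<le> U"
    and "\<forall>A \<in> {L..U}. totally_positive A"
  defines "D \<equiv> {det (down_mat n L U), det (up_mat n L U)}"
  shows "det ` {L..U} = {Min D..Max D}"
proof -
  let ?P = "down_mat n L U" and ?Q = "up_mat n L U"
  note index = checkerboard_index[OF assms(1,2)]
  have "?P \<in> carrier_mat n n" "?Q \<in> carrier_mat n n"
    using assms(1,2)
    by (auto simp: down_mat_def up_mat_def mid_mat_def rad_mat_def sign_diag_def mat_diag_def)
  \<comment> \<open>Each entry of the two vertices is one of the two bounds, so
    \<open>L \<le> U\<close> places them in the interval.\<close>
  then have P: "?P \<in> {L..U}" and Q: "?Q \<in> {L..U}"
    using assms(1-3) index by (auto simp: mem_interval_mat_iff[OF assms(1,2)] less_eq_mat_def)
  have bounds: "det ?P \<le> det A \<and> det A \<le> det ?Q" if A: "A \<in> {L..U}" for A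
  proof -
    have "L $$ (i, j) \<le> A $$ (i, j) \<and> A $$ (i, j) \<le> U $$ (i, j)" if "i < n" "j < n" for i j
      using A that mem_interval_mat_iff[OF assms(1,2)] by blast
    \<comment> \<open>For even \<open>i + j\<close> the sign is 1 and the vertices bound
      \<open>A\<close> entrywise by \<open>L\<close> and \<open>U\<close>; for odd
      \<open>i + j\<close> both the sign and the roles of \<open>L\<close> and \<open>U\<close> are
      reversed.\<close>
    then show ?thesis
      using assms(4) A P Q
      by (auto simp del: atLeastAtMost_iff intro!: det_mono_checkerboard[OF assms(1,2)] simp: index minus_one_power_iff)
  qed
  have "det ?P \<le> det ?Q"
    using bounds[OF P] by simp
  then have "Min D = det ?P" and "Max D = det ?Q"
    by (simp_all add: D_def)
  then show ?thesis
    using det_image_interval_eq_Icc[OF assms(1,2) P Q bounds] by simp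
qed

end
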